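(* Let $F$ be an infinite Fort space with particular point $b$ and let $(F,G)$ be a transformation group with $G$ abelian. Then: 1. For every ideal $\mathcal I$ on $G$: $(F,G)$ is Li--Yorke chaotic modulo $\mathcal I$ if and only if the set $\{x\in F: xG \text{ is infinite and there exists } h\in G \text{ with } stab(x)h\notin\mathcal I\}$ is uncountable. 2. For every $G$-invariant ideal $\mathcal J$ on $G$: $(F,G)$ is Li--Yorke chaotic modulo $\mathcal J$ if and only if the set $\{x\in F: xG \text{ is infinite and } stab(x)\notin\mathcal J\}$ is uncountable. 3. $(F,G)$ is Li--Yorke chaotic if and only if the set $\{x\in F: xG \text{ and } stab(x) \text{ are both infinite}\}$ is uncountable.
   Context: Fort space: a set $F$ with a point $b\in F$ and the topology $\{U\subseteq F: b\notin U \text{ or } F\setminus U \text{ is finite}\}$; it is compact Hausdorff. A transformation group $(X,G)$ is a compact Hausdorff space $X$, a discrete group $G$ with identity $e$, and a continuous map $X\times G\to X$, $(x,g)\mapsto xg$, with $xe=x$ and $x(gh)=(xg)h$. Write $xG=\{xg:g\in G\}$, $stab(x)=\{g\in G: xg=x\}$ and, for $A\subseteq G$, $Ah=\{ah:a\in A\}$. An ideal on a set $W$ is a nonempty collection $\mathcal I$ of subsets of $W$ closed under subsets and finite unions ($\mathcal I=\mathcal P(W)$ is allowed). An ideal $\mathcal J$ on $G$ is $G$-invariant if $Ag\in\mathcal J$ for all $A\in\mathcal J$, $g\in G$. Let $\mathcal F$ be the unique compatible uniform structure on $X$, and $\mathcal I$ an ideal on $G$. Points $x,y\in X$ are proximal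 if there are $z\in X$ and a net $(g_\lambda)$ in $G$ with $\lim xg_\lambda=z=\lim yg_\lambda$; they are asymptotic modulo $\mathcal I$ if $\{g\in G:(xg,yg)\notin\alpha\}\in\mathcal I$ for every $\alpha\in\mathcal F$; they are scrambled modulo $\mathcal I$ if they are proximal and not asymptotic modulo $\mathcal I$. A set $D\subseteq X$ with at least two elements is a scrambled set modulo $\mathcal I$ if every two distinct points of $D$ are scrambled modulo $\mathcal I$. $(X,G)$ is Li--Yorke chaotic modulo $\mathcal I$ if it has an uncountable scrambled set modulo $\mathcal I$; it is Li--Yorke chaotic if it is Li--Yorke chaotic modulo the ideal $\mathcal P_{\rm fin}(G)$ of all finite subsets of $G$. *)

theory Defs
  imports "HOL-Analysis.Analysis" "HOL-Algebra.Group_Action"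
begin

definition fort_topology :: "'a set \<Rightarrow> 'a \<Rightarrow> 'a topology" where
  "fort_topology F b = topology (\<lambda>U. U \<subseteq> F \<and> (b \<notin> U \<or> finite (F - U)))"

lemma openin_fort_topology:
  "openin (fort_topology F b) U \<longleftrightarrow> U \<subseteq> F \<and> (b \<notin> U \<or> finite (F - U))"
proof -
  let ?P = "\<lambda>U. U \<subseteq> F \<and> (b \<notin> U \<or> finite (F - U))"
  have "?P (S \<inter> T)" if "?P S" "?P T" for S T
    using that by (auto simp: Diff_Int)
  moreover have "?P (\<Union>K)" if K: "\<forall>S\<in>K. ?P S" for K
  proof (cases "b \<in> \<Union>K")
    case True
    then obtain S where "S \<in> K" "b \<in> S" by blast
    then have "finite (F - S)" "F - \<Union>K \<subseteq> F - S" using K by auto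
    then show ?thesis using finite_subset K by blast
  qed (use K in blast)
  ultimately have "istopology ?P" unfolding istopology_def by blast
  then show ?thesis by (simp add: fort_topology_def)
qed

lemma topspace_fort_topology [simp]: "topspace (fort_topology F b) = F"
proof
  show "topspace (fort_topology F b) \<subseteq> F"
    using openin_topspace[of "fort_topology F b"] unfolding openin_fort_topology by (rule conjunct1)
  show "F \<subseteq> topspace (fort_topology F b)"
    by (rule openin_subset) (simp add: openin_fort_topology)
qed

text \<open>
  A right action, with \<open>act g x\<close> standing for \<open>xg\<close>; this is the argument order of the library's
  \<^const>\<open>orbit\<close> and \<^const>\<open>stabilizer\<close>, so that \<open>xG\<close> is \<open>orbit G act x\<close> and \<open>stab(x)\<close> is
  \<open>stabilizer G act x\<close>. The library locale \<^locale>\<open>group_action\<close> is about left actions.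
\<close>

locale transformation_group =
  fixes X :: "'x topology" and G (structure) and act :: "'g \<Rightarrow> 'x \<Rightarrow> 'x"
  assumes compact: "compact_space X"
    and Hausdorff: "Hausdorff_space X"
    and group: "group G"
    and continuous:
      "continuous_map (prod_topology X (discrete_topology (carrier G))) X (\<lambda>(x, g). act g x)"
    and act_one: "x \<in> topspace X \<Longrightarrow> act \<one> x = x"
    and act_mult: "\<lbrakk>x \<in> topspace X; g \<in> carrier G; h \<in> carrier G\<rbrakk>
      \<Longrightarrow> act (g \<otimes> h) x = act h (act g x)"

definition set_ideal :: "'a set \<Rightarrow> 'a set set \<Rightarrow> bool" where
  "set_ideal W I \<longleftrightarrow> I \<noteq> {} \<and> I \<subseteq> Pow W \<and>
     (\<forall>A\<in>I. \<forall>B. B \<subseteq> A \<longrightarrow> B \<in> I) \<and> (\<forall>A\<in>I. \<forall>B\<in>I. A \<union> B \<in> I)"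

definition invariant_ideal :: "('g, 'm) monoid_scheme \<Rightarrow> 'g set set \<Rightarrow> bool" where
  "invariant_ideal G J \<longleftrightarrow> set_ideal (carrier G) J \<and> (\<forall>A\<in>J. \<forall>g\<in>carrier G. A #>\<^bsub>G\<^esub> g \<in> J)"

text \<open>
  Uniform structures in terms of entourages, on a carrier set; the library's uniform spaces are
  tied to a type class.
\<close>

definition uniform_structure :: "'a set \<Rightarrow> ('a \<times> 'a) set set \<Rightarrow> bool" where
  "uniform_structure S \<U> \<longleftrightarrow>
     \<U> \<noteq> {} \<and>
     (\<forall>\<alpha>\<in>\<U>. \<alpha> \<subseteq> S \<times> S \<and> Id_on S \<subseteq> \<alpha>) \<and>
     (\<forall>\<alpha>\<in>\<U>. \<forall>\<beta>. \<alpha> \<subseteq> \<beta> \<and> \<beta> \<subseteq> S \<times> S \<longrightarrow> \<beta> \<in> \<U>) \<and>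
     (\<forall>\<alpha>\<in>\<U>. \<forall>\<beta>\<in>\<U>. \<alpha> \<inter> \<beta> \<in> \<U>) \<and>
     (\<forall>\<alpha>\<in>\<U>. \<alpha>\<inverse> \<in> \<U>) \<and>
     (\<forall>\<alpha>\<in>\<U>. \<exists>\<beta>\<in>\<U>. \<beta> O \<beta> \<subseteq> \<alpha>)"

definition compatible_uniform_structure :: "'a topology \<Rightarrow> ('a \<times> 'a) set set \<Rightarrow> bool" where
  "compatible_uniform_structure X \<U> \<longleftrightarrow> uniform_structure (topspace X) \<U> \<and>
     (\<forall>S. openin X S \<longleftrightarrow> S \<subseteq> topspace X \<and> (\<forall>x\<in>S. \<exists>\<alpha>\<in>\<U>. \<alpha> `` {x} \<subseteq> S))"

definition the_uniform_structure :: "'a topology \<Rightarrow> ('a \<times> 'a) set set" where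
  "the_uniform_structure X = (THE \<U>. compatible_uniform_structure X \<U>)"

text \<open>
  Unique existence for compact Hausdorff spaces: the entourages are the neighbourhoods of the
  diagonal.
\<close>

definition diagonal_nbhds :: "'a topology \<Rightarrow> ('a \<times> 'a) set set" where
  "diagonal_nbhds X = {\<alpha>. \<alpha> \<subseteq> topspace X \<times> topspace X \<and>
     (\<exists>W. openin (prod_topology X X) W \<and> Id_on (topspace X) \<subseteq> W \<and> W \<subseteq> \<alpha>)}"

lemma diagonal_nbhdsI:
  assumes "openin (prod_topology X X) W" "Id_on (topspace X) \<subseteq> W" "W \<subseteq> \<alpha>"
    "\<alpha> \<subseteq> topspace X \<times> topspace X"
  shows "\<alpha> \<in> diagonal_nbhds X"
  unfolding diagonal_nbhds_def by (intro CollectI conjI exI[of _ W] assms)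

lemma diagonal_nbhdsE:
  assumes "\<alpha> \<in> diagonal_nbhds X"
  obtains W where "openin (prod_topology X X) W" "Id_on (topspace X) \<subseteq> W" "W \<subseteq> \<alpha>"
    "\<alpha> \<subseteq> topspace X \<times> topspace X"
  using assms unfolding diagonal_nbhds_def by (elim CollectE conjE exE)

lemma diagonal_square:
  assumes "openin (prod_topology X X) W" "Id_on (topspace X) \<subseteq> W" "x \<in> topspace X"
  obtains U where "openin X U" "x \<in> U" "U \<times> U \<subseteq> W"
proof -
  have "(x, x) \<in> W" using assms by auto
  then obtain U V where "openin X U" "openin X V" "x \<in> U" "x \<in> V" "U \<times> V \<subseteq> W"
    using assms(1) unfolding openin_prod_topology_alt by meson
  then show thesis by (intro that[of "U \<inter> V"]) auto
qed

lemma compact_space_finite_subcover: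
  assumes c: "compact_space X" and N: "\<And>x. x \<in> topspace X \<Longrightarrow> openin X (N x) \<and> x \<in> N x"
  obtains A where "finite A" "A \<subseteq> topspace X" "topspace X \<subseteq> \<Union>(N ` A)"
proof -
  have "\<forall>U\<in>N ` topspace X. openin X U" "topspace X \<subseteq> \<Union>(N ` topspace X)" using N by blast+
  then obtain \<F> where "finite \<F>" "\<F> \<subseteq> N ` topspace X" "topspace X \<subseteq> \<Union>\<F>"
    using c unfolding compact_space_alt by meson
  then show thesis using that finite_subset_image[of \<F> N] by metis
qed

lemma compatible_diagonal_nbhds:
  assumes c: "compact_space X" and H: "Hausdorff_space X"
  shows "compatible_uniform_structure X (diagonal_nbhds X)"
proof -
  let ?S = "topspace X"
  have half: "\<exists>\<beta>\<in>diagonal_nbhds X. \<beta> O \<beta> \<subseteq> \<alpha>" if "\<alpha> \<in> diagonal_nbhds X" for \<alpha>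
  proof -
    from that obtain W where W: "openin (prod_topology X X) W" "Id_on ?S \<subseteq> W" "W \<subseteq> \<alpha>"
      unfolding diagonal_nbhds_def by auto
    have "regular_space X"
      using c H compact_Hausdorff_imp_regular_space by blast
    have "\<exists>U N K. openin X U \<and> openin X N \<and> closedin X K \<and> x \<in> N \<and> N \<subseteq> K \<and> K \<subseteq> U \<and> U \<times> U \<subseteq> W"
      if x: "x \<in> ?S" for x
    proof -
      obtain U where "openin X U" "x \<in> U" "U \<times> U \<subseteq> W"
        using diagonal_square[OF W(1,2) x] by blast
      moreover from this \<open>regular_space X\<close> obtain N K
        where "openin X N" "closedin X K" "x \<in> N" "N \<subseteq> K" "K \<subseteq> U"
        unfolding neighbourhood_base_of_closedin [symmetric] neighbourhood_base_of by metis
      ultimately show ?thesis by blast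
    qed
    then obtain U N K where UNK: "\<And>x. x \<in> ?S \<Longrightarrow> openin X (U x) \<and> openin X (N x) \<and> closedin X (K x)
        \<and> x \<in> N x \<and> N x \<subseteq> K x \<and> K x \<subseteq> U x \<and> U x \<times> U x \<subseteq> W"
      by metis
    obtain A where A: "finite A" "A \<subseteq> ?S" "?S \<subseteq> \<Union>(N ` A)"
      using compact_space_finite_subcover[OF c, of N] UNK by blast
    define V where "V = (\<Inter>x\<in>A. U x \<times> U x \<union> (?S - K x) \<times> (?S - K x)) \<inter> ?S \<times> ?S"
    have "openin (prod_topology X X) (U x \<times> U x \<union> (?S - K x) \<times> (?S - K x))" if "x \<in> A" for x
    proof -
      have "x \<in> ?S" using that A by blast
      then have "openin X (U x)" "closedin X (K x)" using UNK by blast+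
      then have "openin X (U x)" "openin X (?S - K x)" by (simp_all add: openin_diff)
      then show ?thesis by (intro openin_Un) (simp_all add: openin_prod_Times_iff)
    qed
    from openin_INT[OF A(1) this] have "openin (prod_topology X X) V"
      unfolding V_def by (simp only: topspace_prod_topology)
    moreover have "Id_on ?S \<subseteq> V" unfolding V_def using UNK A by blast
    ultimately have "V \<in> diagonal_nbhds X" unfolding diagonal_nbhds_def V_def by blast
    moreover have "V O V \<subseteq> \<alpha>"
    proof clarify
      fix u v w assume uv: "(u, v) \<in> V" "(v, w) \<in> V"
      then have "v \<in> ?S" unfolding V_def by blast
      then obtain x where "x \<in> A" "v \<in> N x" using A by blast
      then have "u \<in> U x" "w \<in> U x" "U x \<times> U x \<subseteq> W" using uv UNK[of x] A unfolding V_def by blast+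
      then show "(u, w) \<in> \<alpha>" using W by blast
    qed
    ultimately show ?thesis by blast
  qed
  have conv: "\<alpha>\<inverse> \<in> diagonal_nbhds X" if "\<alpha> \<in> diagonal_nbhds X" for \<alpha>
  proof -
    from that obtain W where W: "openin (prod_topology X X) W" "Id_on ?S \<subseteq> W" "W \<subseteq> \<alpha>" "\<alpha> \<subseteq> ?S \<times> ?S"
      unfolding diagonal_nbhds_def by auto
    have "openin (prod_topology X X) (W\<inverse>)"
      unfolding openin_prod_topology_alt
    proof (intro allI impI)
      fix u v assume "(u, v) \<in> W\<inverse>"
      then obtain A B where "openin X A" "openin X B" "v \<in> A" "u \<in> B" "A \<times> B \<subseteq> W"
        using W(1) unfolding openin_prod_topology_alt by (meson converse_iff)
      then show "\<exists>U V. openin X U \<and> openin X V \<and> u \<in> U \<and> v \<in> V \<and> U \<times> V \<subseteq> W\<inverse>"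
        by (intro exI[of _ B] exI[of _ A] conjI) auto
    qed
    moreover have "Id_on ?S \<subseteq> W\<inverse>" "W\<inverse> \<subseteq> \<alpha>\<inverse>" "\<alpha>\<inverse> \<subseteq> ?S \<times> ?S" using W(2-4) by auto
    ultimately show ?thesis unfolding diagonal_nbhds_def by auto
  qed
  have inter: "\<alpha> \<inter> \<beta> \<in> diagonal_nbhds X"
    if "\<alpha> \<in> diagonal_nbhds X" "\<beta> \<in> diagonal_nbhds X" for \<alpha> \<beta>
  proof -
    from that obtain W W' where "openin (prod_topology X X) W" "Id_on ?S \<subseteq> W" "W \<subseteq> \<alpha>" "\<alpha> \<subseteq> ?S \<times> ?S"
      and "openin (prod_topology X X) W'" "Id_on ?S \<subseteq> W'" "W' \<subseteq> \<beta>"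
      unfolding diagonal_nbhds_def by auto
    then show ?thesis unfolding diagonal_nbhds_def
      by (intro CollectI conjI exI[of _ "W \<inter> W'"]) auto
  qed
  have "openin (prod_topology X X) (?S \<times> ?S)" "Id_on ?S \<subseteq> ?S \<times> ?S"
    by (auto simp: openin_prod_Times_iff)
  then have "?S \<times> ?S \<in> diagonal_nbhds X" unfolding diagonal_nbhds_def by auto
  then have "diagonal_nbhds X \<noteq> {}" by blast
  moreover have "\<forall>\<alpha>\<in>diagonal_nbhds X. \<alpha> \<subseteq> ?S \<times> ?S \<and> Id_on ?S \<subseteq> \<alpha>"
    unfolding diagonal_nbhds_def by auto
  moreover have "\<forall>\<alpha>\<in>diagonal_nbhds X. \<forall>\<beta>. \<alpha> \<subseteq> \<beta> \<and> \<beta> \<subseteq> ?S \<times> ?S \<longrightarrow> \<beta> \<in> diagonal_nbhds X"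
  proof (intro ballI allI impI, elim conjE)
    fix \<alpha> \<beta> assume "\<alpha> \<in> diagonal_nbhds X" and b: "\<alpha> \<subseteq> \<beta>" "\<beta> \<subseteq> ?S \<times> ?S"
    then obtain W where W: "openin (prod_topology X X) W" "Id_on ?S \<subseteq> W" "W \<subseteq> \<alpha>"
      by (elim diagonal_nbhdsE)
    show "\<beta> \<in> diagonal_nbhds X"
      by (rule diagonal_nbhdsI[OF W(1,2) subset_trans[OF W(3) b(1)] b(2)])
  qed
  moreover have "\<forall>\<alpha>\<in>diagonal_nbhds X. \<forall>\<beta>\<in>diagonal_nbhds X. \<alpha> \<inter> \<beta> \<in> diagonal_nbhds X"
    by (intro ballI inter)
  moreover have "\<forall>\<alpha>\<in>diagonal_nbhds X. \<alpha>\<inverse> \<in> diagonal_nbhds X" by (intro ballI conv)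
  moreover have "\<forall>\<alpha>\<in>diagonal_nbhds X. \<exists>\<beta>\<in>diagonal_nbhds X. \<beta> O \<beta> \<subseteq> \<alpha>" by (intro ballI half)
  ultimately have us: "uniform_structure ?S (diagonal_nbhds X)"
    unfolding uniform_structure_def by (intro conjI)
  have fwd: "\<exists>\<alpha>\<in>diagonal_nbhds X. \<alpha> `` {x} \<subseteq> S" if S: "openin X S" "x \<in> S" for S x
  proof -
    let ?W = "S \<times> S \<union> (?S - {x}) \<times> (?S - {x})"
    have "openin X (?S - {x})"
      using Hausdorff_imp_t1_space[OF H] openin_topspace t1_space_openin_delete_alt by metis
    then have "openin (prod_topology X X) ?W"
      using S by (intro openin_Un) (auto simp: openin_prod_Times_iff)
    moreover have "?W \<subseteq> ?S \<times> ?S" using openin_subset[OF S(1)] by auto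
    moreover have "Id_on ?S \<subseteq> ?W" using S(2) by auto
    ultimately have "?W \<in> diagonal_nbhds X" by (intro diagonal_nbhdsI[of X ?W ?W]) auto
    moreover have "?W `` {x} \<subseteq> S" by auto
    ultimately show ?thesis by (intro bexI[of _ ?W])
  qed
  have bwd: "openin X S" if S: "S \<subseteq> ?S" "\<forall>x\<in>S. \<exists>\<alpha>\<in>diagonal_nbhds X. \<alpha> `` {x} \<subseteq> S" for S
  proof (subst openin_subopen, intro ballI)
    fix x assume x: "x \<in> S"
    then obtain \<alpha> where "\<alpha> \<in> diagonal_nbhds X" and a: "\<alpha> `` {x} \<subseteq> S" using S by blast
    then obtain W where W: "openin (prod_topology X X) W" "Id_on ?S \<subseteq> W" "W \<subseteq> \<alpha>"
      by (elim diagonal_nbhdsE)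
    have "x \<in> ?S" using x S by blast
    with W obtain U where U: "openin X U" "x \<in> U" "U \<times> U \<subseteq> W" by (elim diagonal_square)
    then have "U \<subseteq> S" using W a by blast
    then show "\<exists>T. openin X T \<and> x \<in> T \<and> T \<subseteq> S" using U by blast
  qed
  have "openin X S \<longleftrightarrow> S \<subseteq> ?S \<and> (\<forall>x\<in>S. \<exists>\<alpha>\<in>diagonal_nbhds X. \<alpha> `` {x} \<subseteq> S)" for S
  proof
    assume "openin X S"
    then show "S \<subseteq> ?S \<and> (\<forall>x\<in>S. \<exists>\<alpha>\<in>diagonal_nbhds X. \<alpha> `` {x} \<subseteq> S)"
      by (intro conjI ballI fwd openin_subset)
  next
    assume "S \<subseteq> ?S \<and> (\<forall>x\<in>S. \<exists>\<alpha>\<in>diagonal_nbhds X. \<alpha> `` {x} \<subseteq> S)"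
    then show "openin X S" by (elim conjE) (rule bwd)
  qed
  with us show ?thesis
    unfolding compatible_uniform_structure_def by (intro conjI allI)
qed

lemma compatible_imp_diagonal_nbhds:
  assumes c: "compact_space X" and U: "compatible_uniform_structure X \<U>"
  shows "\<U> = diagonal_nbhds X"
proof -
  let ?S = "topspace X"
  have ne: "\<U> \<noteq> {}"
    and refl': "\<forall>\<alpha>\<in>\<U>. \<alpha> \<subseteq> ?S \<times> ?S \<and> Id_on ?S \<subseteq> \<alpha>"
    and up': "\<forall>\<alpha>\<in>\<U>. \<forall>\<beta>. \<alpha> \<subseteq> \<beta> \<and> \<beta> \<subseteq> ?S \<times> ?S \<longrightarrow> \<beta> \<in> \<U>"
    and inter': "\<forall>\<alpha>\<in>\<U>. \<forall>\<beta>\<in>\<U>. \<alpha> \<inter> \<beta> \<in> \<U>"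
    and conv': "\<forall>\<alpha>\<in>\<U>. \<alpha>\<inverse> \<in> \<U>"
    and half': "\<forall>\<alpha>\<in>\<U>. \<exists>\<beta>\<in>\<U>. \<beta> O \<beta> \<subseteq> \<alpha>"
    and op': "\<forall>S. openin X S \<longleftrightarrow> S \<subseteq> ?S \<and> (\<forall>x\<in>S. \<exists>\<alpha>\<in>\<U>. \<alpha> `` {x} \<subseteq> S)"
    using U unfolding compatible_uniform_structure_def uniform_structure_def
    by - (elim conjE, assumption)+
  note inter = inter'[rule_format] and conv = conv'[rule_format]
    and half = half'[rule_format] and op = op'[THEN spec]
  have refl: "\<alpha> \<subseteq> ?S \<times> ?S" "x \<in> ?S \<Longrightarrow> (x, x) \<in> \<alpha>" if "\<alpha> \<in> \<U>" for \<alpha> x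
    using that refl' by auto
  have up: "\<beta> \<in> \<U>" if "\<alpha> \<in> \<U>" "\<alpha> \<subseteq> \<beta>" "\<beta> \<subseteq> ?S \<times> ?S" for \<alpha> \<beta>
    using that up' by metis
  have int: "\<exists>N. openin X N \<and> x \<in> N \<and> N \<subseteq> \<alpha> `` {x}" if a: "\<alpha> \<in> \<U>" "x \<in> ?S" for \<alpha> x
  proof -
    let ?N = "{y \<in> ?S. \<exists>\<gamma>\<in>\<U>. \<gamma> `` {y} \<subseteq> \<alpha> `` {x}}"
    have "\<exists>\<gamma>\<in>\<U>. \<gamma> `` {y} \<subseteq> ?N" if y: "y \<in> ?N" for y
    proof -
      obtain \<gamma> where "\<gamma> \<in> \<U>" "\<gamma> `` {y} \<subseteq> \<alpha> `` {x}" using y by blast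
      then obtain \<delta> where d: "\<delta> \<in> \<U>" "\<delta> O \<delta> \<subseteq> \<gamma>" using half by blast
      have "\<delta> `` {y} \<subseteq> ?N"
      proof
        fix z assume z: "z \<in> \<delta> `` {y}"
        then have "\<delta> `` {z} \<subseteq> \<gamma> `` {y}" using d by blast
        then have "\<delta> `` {z} \<subseteq> \<alpha> `` {x}" using \<open>\<gamma> `` {y} \<subseteq> \<alpha> `` {x}\<close> by blast
        moreover have "z \<in> ?S" using z refl(1)[OF d(1)] by blast
        ultimately show "z \<in> ?N" using d(1) by blast
      qed
      then show ?thesis using d by blast
    qed
    then have "openin X ?N" using op[of ?N] by simp
    moreover have "x \<in> ?N" using a by blast
    moreover have "?N \<subseteq> \<alpha> `` {x}"
    proof
      fix y assume "y \<in> ?N"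
      then obtain \<gamma> where "y \<in> ?S" "\<gamma> \<in> \<U>" "\<gamma> `` {y} \<subseteq> \<alpha> `` {x}" by blast
      then show "y \<in> \<alpha> `` {x}" using refl(2)[of \<gamma> y] by blast
    qed
    ultimately show ?thesis by (intro exI[of _ ?N] conjI)
  qed
  show ?thesis
  proof (intro equalityI subsetI)
    fix \<alpha> assume a: "\<alpha> \<in> \<U>"
    then obtain \<beta> where "\<beta> \<in> \<U>" "\<beta> O \<beta> \<subseteq> \<alpha>" using half by blast
    define \<gamma> where "\<gamma> = \<beta> \<inter> \<beta>\<inverse>"
    have "\<gamma> \<in> \<U>" unfolding \<gamma>_def by (intro inter conv \<open>\<beta> \<in> \<U>\<close>)
    moreover have "\<gamma>\<inverse> = \<gamma>" "\<gamma> O \<gamma> \<subseteq> \<alpha>"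
      using \<open>\<beta> O \<beta> \<subseteq> \<alpha>\<close> unfolding \<gamma>_def by blast+
    ultimately have g: "\<gamma> \<in> \<U>" "\<gamma>\<inverse> = \<gamma>" "\<gamma> O \<gamma> \<subseteq> \<alpha>" by this+
    obtain N where N: "\<And>x. x \<in> ?S \<Longrightarrow> openin X (N x) \<and> x \<in> N x \<and> N x \<subseteq> \<gamma> `` {x}"
      using int[OF g(1)] by metis
    let ?W = "\<Union>x\<in>?S. N x \<times> N x"
    have "openin (prod_topology X X) ?W"
    proof (rule openin_Union, clarify)
      fix x assume "x \<in> ?S"
      then show "openin (prod_topology X X) (N x \<times> N x)" using N by (simp add: openin_prod_Times_iff)
    qed
    moreover have "Id_on ?S \<subseteq> ?W"
    proof
      fix p assume "p \<in> Id_on ?S"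
      then obtain x where "p = (x, x)" "x \<in> ?S" by blast
      then show "p \<in> ?W" using N[of x] by blast
    qed
    moreover have "?W \<subseteq> \<alpha>"
    proof clarify
      fix x u v assume "x \<in> ?S" "u \<in> N x" "v \<in> N x"
      then have "(x, u) \<in> \<gamma>" "(x, v) \<in> \<gamma>" using N[of x] by blast+
      then have "(u, x) \<in> \<gamma>" using g(2) by blast
      then show "(u, v) \<in> \<alpha>" using g(3) \<open>(x, v) \<in> \<gamma>\<close> by blast
    qed
    ultimately show "\<alpha> \<in> diagonal_nbhds X"
      using refl(1)[OF a] by (rule diagonal_nbhdsI)
  next
    fix \<alpha> assume "\<alpha> \<in> diagonal_nbhds X"
    then obtain W where W: "openin (prod_topology X X) W" "Id_on ?S \<subseteq> W" "W \<subseteq> \<alpha>" "\<alpha> \<subseteq> ?S \<times> ?S"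
      by (elim diagonal_nbhdsE)
    have "\<exists>T \<beta> N. T \<times> T \<subseteq> W \<and> \<beta> \<in> \<U> \<and> (\<beta> O \<beta>) `` {x} \<subseteq> T \<and> openin X N \<and> x \<in> N \<and> N \<subseteq> \<beta> `` {x}"
      if x: "x \<in> ?S" for x
    proof -
      obtain T where T: "openin X T" "x \<in> T" "T \<times> T \<subseteq> W"
        using diagonal_square[OF W(1,2) x] by blast
      then obtain \<gamma> where g: "\<gamma> \<in> \<U>" "\<gamma> `` {x} \<subseteq> T" using op[of T] by blast
      then obtain \<beta> where b: "\<beta> \<in> \<U>" "\<beta> O \<beta> \<subseteq> \<gamma>" using half by blast
      obtain N where N: "openin X N" "x \<in> N" "N \<subseteq> \<beta> `` {x}" using int[OF b(1) x] by blast
      have "(\<beta> O \<beta>) `` {x} \<subseteq> T" using g(2) b(2) by blast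
      then show ?thesis using T(3) b(1) N by (intro exI conjI)
    qed
    then obtain T B N where TBN: "\<And>x. x \<in> ?S \<Longrightarrow> T x \<times> T x \<subseteq> W \<and> B x \<in> \<U> \<and>
        (B x O B x) `` {x} \<subseteq> T x \<and> openin X (N x) \<and> x \<in> N x \<and> N x \<subseteq> B x `` {x}"
      by metis
    obtain A where A: "finite A" "A \<subseteq> ?S" "?S \<subseteq> \<Union>(N ` A)"
      using compact_space_finite_subcover[OF c, of N] TBN by blast
    have full: "?S \<times> ?S \<in> \<U>"
    proof -
      obtain \<alpha> where "\<alpha> \<in> \<U>" using ne by blast
      then show ?thesis using up[OF _ refl(1)] by simp
    qed
    have "(\<Inter>x\<in>A. B x) \<inter> ?S \<times> ?S \<in> \<U>" using A(1,2)
    proof (induction A rule: finite_induct)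
      case empty then show ?case using full by simp
    next
      case (insert x A)
      have "B x \<inter> ((\<Inter>x\<in>A. B x) \<inter> ?S \<times> ?S) \<in> \<U>"
        using TBN[of x] insert.prems by (intro inter insert.IH) auto
      then show ?case by (simp add: Int_assoc)
    qed
    moreover have "(\<Inter>x\<in>A. B x) \<inter> ?S \<times> ?S \<subseteq> \<alpha>"
    proof clarify
      fix u v assume uv: "(u, v) \<in> (\<Inter>x\<in>A. B x)" "u \<in> ?S" "v \<in> ?S"
      then obtain x where x: "x \<in> A" "u \<in> N x" using A by blast
      then have "(x, u) \<in> B x" "(u, v) \<in> B x" "(u, u) \<in> B x"
        using uv TBN[of x] A refl(2)[of "B x" u] by blast+
      then have "u \<in> T x" "v \<in> T x" using TBN[of x] x A by blast+
      then show "(u, v) \<in> \<alpha>" using TBN[of x] x A W by blast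
    qed
    ultimately show "\<alpha> \<in> \<U>" using up W(4) by metis
  qed
qed

lemma the_uniform_structure_compact_Hausdorff:
  assumes "compact_space X" "Hausdorff_space X"
  shows "\<exists>!\<U>. compatible_uniform_structure X \<U>"
    and "the_uniform_structure X = diagonal_nbhds X"
proof -
  show "\<exists>!\<U>. compatible_uniform_structure X \<U>"
    using compatible_diagonal_nbhds compatible_imp_diagonal_nbhds assms by metis
  show "the_uniform_structure X = diagonal_nbhds X"
    unfolding the_uniform_structure_def
    using compatible_diagonal_nbhds compatible_imp_diagonal_nbhds assms by (metis the_equality)
qed

text \<open>
  Nets are rendered by proper filters, as usual in the library; the two lemmas after the definition
  show that it says the same as the formulation with nets, whatever the index type.
\<close>

definition proximal ::
    "'x topology \<Rightarrow> ('g, 'm) monoid_scheme \<Rightarrow> ('g \<Rightarrow> 'x \<Rightarrow> 'x) \<Rightarrow> 'x \<Rightarrow> 'x \<Rightarrow> bool" where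
  "proximal X G act x y \<longleftrightarrow> (\<exists>z\<in>topspace X. \<exists>N. N \<noteq> bot \<and> (\<forall>\<^sub>F g in N. g \<in> carrier G) \<and>
     limitin X (\<lambda>g. act g x) z N \<and> limitin X (\<lambda>g. act g y) z N)"

definition directed :: "'i set \<Rightarrow> ('i \<Rightarrow> 'i \<Rightarrow> bool) \<Rightarrow> bool" where
  "directed I rel \<longleftrightarrow> I \<noteq> {} \<and> (\<forall>i\<in>I. rel i i) \<and>
     (\<forall>i\<in>I. \<forall>j\<in>I. \<forall>k\<in>I. rel i j \<and> rel j k \<longrightarrow> rel i k) \<and>
     (\<forall>i\<in>I. \<forall>j\<in>I. \<exists>k\<in>I. rel i k \<and> rel j k)"

definition net_limit :: "'x topology \<Rightarrow> 'i set \<Rightarrow> ('i \<Rightarrow> 'i \<Rightarrow> bool) \<Rightarrow> ('i \<Rightarrow> 'x) \<Rightarrow> 'x \<Rightarrow> bool" where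
  "net_limit X I rel f z \<longleftrightarrow> z \<in> topspace X \<and>
     (\<forall>U. openin X U \<and> z \<in> U \<longrightarrow> (\<exists>i\<in>I. \<forall>j\<in>I. rel i j \<longrightarrow> f j \<in> U))"

lemma proximal_if_net:
  assumes d: "directed I rel" and g: "\<And>i. i \<in> I \<Longrightarrow> g i \<in> carrier G"
    and "net_limit X I rel (\<lambda>i. act (g i) x) z" "net_limit X I rel (\<lambda>i. act (g i) y) z"
  shows "proximal X G act x y"
proof -
  define N where "N = (INF i\<in>I. principal (g ` {j \<in> I. rel i j}))"
  have ev: "eventually P N \<longleftrightarrow> (\<exists>i\<in>I. \<forall>j\<in>I. rel i j \<longrightarrow> P (g j))" for P
  proof -
    have "eventually P N \<longleftrightarrow> (\<exists>i\<in>I. eventually P (principal (g ` {j \<in> I. rel i j})))"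
      unfolding N_def
    proof (rule eventually_INF_base)
      show "I \<noteq> {}" using d unfolding directed_def by blast
      fix i j assume ij: "i \<in> I" "j \<in> I"
      then obtain k where "k \<in> I" "rel i k" "rel j k" using d unfolding directed_def by blast
      moreover have "rel i l" "rel j l" if "l \<in> I" "rel k l" for l
        using that ij \<open>k \<in> I\<close> \<open>rel i k\<close> \<open>rel j k\<close> d unfolding directed_def by meson+
      ultimately have "principal (g ` {l \<in> I. rel k l})
          \<le> inf (principal (g ` {l \<in> I. rel i l})) (principal (g ` {l \<in> I. rel j l}))"
        by auto
      then show "\<exists>k\<in>I. principal (g ` {l \<in> I. rel k l})
          \<le> inf (principal (g ` {l \<in> I. rel i l})) (principal (g ` {l \<in> I. rel j l}))"
        using \<open>k \<in> I\<close> by (rule bexI)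
    qed
    then show ?thesis by (auto simp: eventually_principal)
  qed
  have "N \<noteq> bot"
    using d unfolding trivial_limit_def ev directed_def by blast
  moreover have "\<forall>\<^sub>F h in N. h \<in> carrier G" using d g unfolding ev directed_def by blast
  moreover have "limitin X f z N \<longleftrightarrow> net_limit X I rel (\<lambda>i. f (g i)) z" for f
    unfolding limitin_def net_limit_def ev ..
  moreover have "z \<in> topspace X" using assms(3) unfolding net_limit_def by blast
  ultimately show ?thesis
    using assms(3,4) unfolding proximal_def by (intro bexI[of _ z] exI[of _ N]) simp_all
qed

lemma net_if_proximal:
  fixes X :: "'x topology"
  assumes "proximal X G act x y"
  obtains z and I :: "'x set set" and rel g where
    "directed I rel" "\<And>i. i \<in> I \<Longrightarrow> g i \<in> carrier G"
    "net_limit X I rel (\<lambda>i. act (g i) x) z" "net_limit X I rel (\<lambda>i. act (g i) y) z"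
proof -
  from assms obtain z N where z: "z \<in> topspace X" and N: "N \<noteq> bot" "\<forall>\<^sub>F g in N. g \<in> carrier G"
    and l: "limitin X (\<lambda>g. act g x) z N" "limitin X (\<lambda>g. act g y) z N"
    unfolding proximal_def by blast
  let ?I = "{U. openin X U \<and> z \<in> U}"
  have "\<exists>g. g \<in> carrier G \<and> act g x \<in> U \<and> act g y \<in> U" if "U \<in> ?I" for U
  proof -
    have "\<forall>\<^sub>F g in N. g \<in> carrier G \<and> act g x \<in> U \<and> act g y \<in> U"
      using that l N(2) unfolding limitin_def by (auto intro!: eventually_conj)
    then show ?thesis using N(1) eventually_happens' by blast
  qed
  then obtain g where g: "\<And>U. U \<in> ?I \<Longrightarrow> g U \<in> carrier G \<and> act (g U) x \<in> U \<and> act (g U) y \<in> U"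
    by metis
  have "directed ?I (\<lambda>U V. V \<subseteq> U)"
    unfolding directed_def
  proof (intro conjI)
    show "\<forall>i\<in>?I. \<forall>j\<in>?I. \<exists>k\<in>?I. k \<subseteq> i \<and> k \<subseteq> j"
      by (metis (no_types, lifting) Int_iff Int_lower1 Int_lower2 mem_Collect_eq openin_Int)
  qed (use z in auto)
  moreover have "net_limit X ?I (\<lambda>U V. V \<subseteq> U) (\<lambda>i. act (g i) w) z" if "w \<in> {x, y}" for w
    unfolding net_limit_def
  proof (intro conjI allI impI z)
    fix U assume U: "openin X U \<and> z \<in> U"
    have "act (g V) w \<in> U" if "V \<in> ?I" "V \<subseteq> U" for V
      using g[OF that(1)] that(2) \<open>w \<in> {x, y}\<close> by blast
    then show "\<exists>V\<in>?I. \<forall>V'\<in>?I. V' \<subseteq> V \<longrightarrow> act (g V') w \<in> U"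
      using U by (intro bexI[of _ U]) auto
  qed
  ultimately show thesis using that[of ?I "\<lambda>U V. V \<subseteq> U" g z] g by simp
qed

definition asymptotic_mod :: "'x topology \<Rightarrow> ('g, 'm) monoid_scheme \<Rightarrow> ('g \<Rightarrow> 'x \<Rightarrow> 'x) \<Rightarrow>
    'g set set \<Rightarrow> 'x \<Rightarrow> 'x \<Rightarrow> bool" where
  "asymptotic_mod X G act I x y \<longleftrightarrow>
     (\<forall>\<alpha>\<in>the_uniform_structure X. {g \<in> carrier G. (act g x, act g y) \<notin> \<alpha>} \<in> I)"

definition scrambled_mod :: "'x topology \<Rightarrow> ('g, 'm) monoid_scheme \<Rightarrow> ('g \<Rightarrow> 'x \<Rightarrow> 'x) \<Rightarrow>
    'g set set \<Rightarrow> 'x \<Rightarrow> 'x \<Rightarrow> bool" where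
  "scrambled_mod X G act I x y \<longleftrightarrow> proximal X G act x y \<and> \<not> asymptotic_mod X G act I x y"

definition scrambled_set_mod :: "'x topology \<Rightarrow> ('g, 'm) monoid_scheme \<Rightarrow> ('g \<Rightarrow> 'x \<Rightarrow> 'x) \<Rightarrow>
    'g set set \<Rightarrow> 'x set \<Rightarrow> bool" where
  "scrambled_set_mod X G act I D \<longleftrightarrow> D \<subseteq> topspace X \<and> (\<exists>x\<in>D. \<exists>y\<in>D. x \<noteq> y) \<and>
     (\<forall>x\<in>D. \<forall>y\<in>D. x \<noteq> y \<longrightarrow> scrambled_mod X G act I x y)"

definition Li_Yorke_chaotic_mod :: "'x topology \<Rightarrow> ('g, 'm) monoid_scheme \<Rightarrow> ('g \<Rightarrow> 'x \<Rightarrow> 'x) \<Rightarrow>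
    'g set set \<Rightarrow> bool" where
  "Li_Yorke_chaotic_mod X G act I \<longleftrightarrow> (\<exists>D. uncountable D \<and> scrambled_set_mod X G act I D)"

definition Li_Yorke_chaotic ::
    "'x topology \<Rightarrow> ('g, 'm) monoid_scheme \<Rightarrow> ('g \<Rightarrow> 'x \<Rightarrow> 'x) \<Rightarrow> bool" where
  "Li_Yorke_chaotic X G act \<longleftrightarrow>
     Li_Yorke_chaotic_mod X G act {A. A \<subseteq> carrier G \<and> finite A}"

end

theory Submission
  imports Defs
begin

text \<open>
  Every transformation of an infinite Fort space fixes the particular point \<open>b\<close>, the only
  non-isolated one. A basic neighbourhood of \<open>b\<close> is the complement of a finite set \<open>H\<close> with
  \<open>b \<notin> H\<close>, and a basic entourage relates two distinct points iff neither lies in such an \<open>H\<close>.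
  Hence both relations that make up scrambling can be read off, for \<open>x \<noteq> y\<close>, from the sets
  \<open>{g. xg \<in> H}\<close> and \<open>{g. yg \<in> H}\<close>, which are finite unions of cosets of the two stabilizers.

  \<^item> A common limit of two distinct points under a net can only be \<open>b\<close>, because all other points
  are isolated and the action is injective. So \<open>x\<close> and \<open>y\<close> are proximal iff for every \<open>H\<close> some \<open>g\<close>
  moves both out of \<open>H\<close>. This says that each of them is \<open>b\<close> or has an infinite orbit
  (\<open>proximal_iff\<close>); the point is that a group is not a finite union of cosets of two subgroups of
  infinite index (\<open>avoid_finite_set\<close>).
  \<^item> They are asymptotic modulo \<open>I\<close> iff all cosets of \<open>stab(x)\<close> and of \<open>stab(y)\<close> are in \<open>I\<close>, where
  the condition on a point is dropped if that point is \<open>b\<close> (\<open>asymptotic_mod_iff\<close>).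

  Let \<open>A\<close> be the set of points with infinite orbit that have some coset of the stabilizer outside
  \<open>I\<close>. Two distinct points are then scrambled iff both lie in \<open>{x. xG is infinite} \<union> {b}\<close> and at
  least one lies in \<open>A\<close>. Therefore every subset of \<open>A\<close> with at least two points is scrambled, and
  a scrambled set has at most one point outside \<open>A\<close>, which is the criterion for an arbitrary ideal.
  If the ideal is invariant, one coset of \<open>stab(x)\<close> belongs to it iff all do; the finite subsets of
  \<open>G\<close> form such an ideal.
\<close>

section \<open>Entourages of a Fort space\<close>

definition fort_entourage :: "'a set \<Rightarrow> 'a set \<Rightarrow> ('a \<times> 'a) set" where
  "fort_entourage F H = {(u, v) \<in> F \<times> F. u = v \<or> u \<notin> H \<and> v \<notin> H}"

lemma openin_fort_singleton: "c \<in> F \<Longrightarrow> c \<noteq> b \<Longrightarrow> openin (fort_topology F b) {c}"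
  by (simp add: openin_fort_topology)

lemma openin_fort_Diff_finite: "finite H \<Longrightarrow> openin (fort_topology F b) (F - H)"
  by (auto simp: openin_fort_topology intro: finite_subset[of _ H])

lemma fort_entourage_in_diagonal_nbhds:
  assumes "finite H" "b \<notin> H"
  shows "fort_entourage F H \<in> diagonal_nbhds (fort_topology F b)"
proof -
  let ?X = "fort_topology F b"
  have eq: "fort_entourage F H = (F - H) \<times> (F - H) \<union> (\<Union>c\<in>H \<inter> F. {c} \<times> {c})"
    unfolding fort_entourage_def by auto
  have "openin (prod_topology ?X ?X) ({c} \<times> {c})" if "c \<in> H \<inter> F" for c
    using that assms(2) openin_fort_singleton[of c F b]
    unfolding openin_prod_Times_iff by blast
  then have "openin (prod_topology ?X ?X) (fort_entourage F H)"
    unfolding eq using openin_fort_Diff_finite[OF assms(1), of F b]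
    by (intro openin_Un openin_Union) (auto simp: openin_prod_Times_iff)
  then show ?thesis
    by (rule diagonal_nbhdsI) (auto simp: fort_entourage_def)
qed

text \<open>
  Only the square \<open>U \<times> U\<close> at the particular point has to be found: the complement of \<open>U\<close> is a
  finite set of isolated points, where the diagonal suffices.
\<close>

lemma diagonal_nbhds_fort_topologyE:
  assumes "\<alpha> \<in> diagonal_nbhds (fort_topology F b)" "b \<in> F"
  obtains H where "finite H" "b \<notin> H" "fort_entourage F H \<subseteq> \<alpha>"
proof -
  obtain W where W: "openin (prod_topology (fort_topology F b) (fort_topology F b)) W"
      "Id_on F \<subseteq> W" "W \<subseteq> \<alpha>"
    using assms(1) by (elim diagonal_nbhdsE) simp
  obtain U where U: "openin (fort_topology F b) U" "b \<in> U" "U \<times> U \<subseteq> W"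
    using diagonal_square[OF W(1), of b] W(2) assms(2) by auto
  show thesis
  proof
    show "finite (F - U)" "b \<notin> F - U" using U by (auto simp: openin_fort_topology)
    show "fort_entourage F (F - U) \<subseteq> \<alpha>"
      using U(3) W(2,3) unfolding fort_entourage_def by blast
  qed
qed

section \<open>Transformation groups on an infinite Fort space\<close>

locale fort_transformation_group =
  transformation_group "fort_topology F b" G act
  for F :: "'x set" and b :: 'x and G :: "('g, 'm) monoid_scheme" (structure)
    and act :: "'g \<Rightarrow> 'x \<Rightarrow> 'x" +
  assumes b_in: "b \<in> F" and infinite_space: "infinite F"
begin

lemma act_closed: "g \<in> carrier G \<Longrightarrow> x \<in> F \<Longrightarrow> act g x \<in> F"
  using continuous_map_image_subset_topspace[OF continuous] by fastforce

lemma act_inv_cancel: "g \<in> carrier G \<Longrightarrow> x \<in> F \<Longrightarrow> act (inv g) (act g x) = x"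
  using act_mult[of x g "inv g"] act_one[of x] group.inv_closed[OF group] group.r_inv[OF group]
  by simp

lemma act_eq_iff:
  "g \<in> carrier G \<Longrightarrow> x \<in> F \<Longrightarrow> y \<in> F \<Longrightarrow> act g x = act g y \<longleftrightarrow> x = y"
  using act_inv_cancel by metis

text \<open>
  If \<open>b\<close> were moved to an isolated point, a whole neighbourhood of \<open>b\<close> would collapse to that
  point; but neighbourhoods of \<open>b\<close> are infinite and transformations are injective.
\<close>

lemma act_b:
  assumes g: "g \<in> carrier G"
  shows "act g b = b"
proof (rule ccontr)
  let ?X = "fort_topology F b" and ?D = "discrete_topology (carrier G)"
  assume nb: "act g b \<noteq> b"
  have "openin (prod_topology ?X ?D)
      {p \<in> topspace (prod_topology ?X ?D). (case p of (x, g) \<Rightarrow> act g x) \<in> {act g b}}"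
    by (intro openin_continuous_map_preimage[OF continuous] openin_fort_singleton)
      (use nb g b_in act_closed in auto)
  moreover have "(b, g) \<in> {p \<in> topspace (prod_topology ?X ?D).
      (case p of (x, g) \<Rightarrow> act g x) \<in> {act g b}}"
    using g b_in by simp
  ultimately obtain U V where U: "openin ?X U" "b \<in> U" "g \<in> V"
      "U \<times> V \<subseteq> {p \<in> topspace (prod_topology ?X ?D). (case p of (x, g) \<Rightarrow> act g x) \<in> {act g b}}"
    unfolding openin_prod_topology_alt by meson
  have "x = b" if "x \<in> U" for x
  proof -
    have "(x, g) \<in> U \<times> V" using that U(3) by blast
    then have "x \<in> F" "act g x = act g b" using U(4) by auto
    then show ?thesis using act_eq_iff g b_in by blast
  qed
  then have "F \<subseteq> insert b (F - U)" by blast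
  moreover have "finite (F - U)" using U(1,2) by (simp add: openin_fort_topology)
  ultimately show False using infinite_space finite_subset by blast
qed

lemma act_eq_b_iff: "g \<in> carrier G \<Longrightarrow> x \<in> F \<Longrightarrow> act g x = b \<longleftrightarrow> x = b"
  using act_eq_iff[of g x b] act_b b_in by simp

lemma finite_orbit_b: "finite (orbit G act b)"
proof -
  have "orbit G act b \<subseteq> {b}" unfolding orbit_def using act_b by auto
  then show ?thesis using finite_subset by blast
qed

lemma coset_stabilizer_eq:
  assumes x: "x \<in> F" and h: "h \<in> carrier G"
  shows "stabilizer G act x #> h = {g \<in> carrier G. act g x = act h x}"
proof (intro equalityI subsetI)
  interpret group G by (rule group)
  show "g \<in> {g \<in> carrier G. act g x = act h x}" if "g \<in> stabilizer G act x #> h" for g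
    using that x h act_mult unfolding r_coset_def stabilizer_def by auto
  show "g \<in> stabilizer G act x #> h" if "g \<in> {g \<in> carrier G. act g x = act h x}" for g
  proof -
    have "act (g \<otimes> inv h) x = x" using that x h act_mult act_inv_cancel by auto
    then have "g \<otimes> inv h \<in> stabilizer G act x" using that h unfolding stabilizer_def by auto
    moreover have "g = g \<otimes> inv h \<otimes> h" using that h by (simp add: m_assoc)
    ultimately show ?thesis unfolding r_coset_def by blast
  qed
qed

section \<open>Proximal pairs\<close>

text \<open>
  B. H. Neumann's lemma for two subgroups, phrased through orbits. If \<open>G\<close> were covered by finitely
  many cosets of \<open>stab(x)\<close>, those of the \<open>g\<close> with \<open>xg \<in> H\<close>, and finitely many cosets of
  \<open>stab(y)\<close>, some coset \<open>stab(x)c\<close> not in the list would be covered by cosets of \<open>stab(y)\<close> alone.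
  By translation so would every coset of \<open>stab(x)\<close>, hence \<open>G\<close> itself, making \<open>yG\<close> finite.
\<close>

lemma avoid_finite_set:
  assumes x: "x \<in> F" and y: "y \<in> F"
    and inf: "infinite (orbit G act x)" "infinite (orbit G act y)" and H: "finite H"
  obtains g where "g \<in> carrier G" "act g x \<notin> H" "act g y \<notin> H"
proof (rule ccontr)
  interpret group G by (rule group)
  assume none: "\<not> thesis"
  note obtained = that
  have cover: "act g x \<in> H \<or> act g y \<in> H" if "g \<in> carrier G" for g
    using none obtained[of g] that by blast
  obtain c where c: "c \<in> carrier G" "act c x \<notin> H"
    using inf(1) H finite_subset[of "orbit G act x" H] unfolding orbit_def by blast
  \<comment> \<open>Finiteness of this partial orbit says that finitely many cosets of \<open>stab(y)\<close> cover
    \<open>stab(x)\<close>.\<close>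
  let ?Y = "(\<lambda>s. act s y) ` stabilizer G act x"
  have "?Y \<subseteq> act (inv c) ` H"
  proof clarify
    fix s assume "s \<in> stabilizer G act x"
    then have s: "s \<in> carrier G" "act s x = x" unfolding stabilizer_def by auto
    then have "act (s \<otimes> c) y \<in> H" using cover[of "s \<otimes> c"] c act_mult x by auto
    moreover have "act s y = act (inv c) (act (s \<otimes> c) y)"
      using s c y act_mult act_inv_cancel act_closed by auto
    ultimately show "act s y \<in> act (inv c) ` H" by blast
  qed
  then have finY: "finite ?Y" using H finite_subset by blast
  have "\<forall>z\<in>H \<inter> orbit G act x. \<exists>a. a \<in> carrier G \<and> act a x = z"
    unfolding orbit_def by auto
  then obtain a where a: "\<And>z. z \<in> H \<inter> orbit G act x \<Longrightarrow> a z \<in> carrier G \<and> act (a z) x = z"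
    by metis
  have "orbit G act y \<subseteq> H \<union> (\<Union>z\<in>H \<inter> orbit G act x. act (a z) ` ?Y)"
  proof
    fix w assume "w \<in> orbit G act y"
    then obtain g where g: "g \<in> carrier G" "w = act g y" unfolding orbit_def by blast
    show "w \<in> H \<union> (\<Union>z\<in>H \<inter> orbit G act x. act (a z) ` ?Y)"
    proof (cases "act g y \<in> H")
      case False
      let ?z = "act g x"
      have z: "?z \<in> H \<inter> orbit G act x" using cover[OF g(1)] False g(1) unfolding orbit_def by blast
      then have "g \<in> stabilizer G act x #> a ?z"
        using coset_stabilizer_eq[OF x, of "a ?z"] a[OF z] g(1) by auto
      then obtain s where s: "s \<in> stabilizer G act x" "g = s \<otimes> a ?z"
        unfolding r_coset_def by blast
      then have "w = act (a ?z) (act s y)"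
        using g(2) act_mult[of y s "a ?z"] y a[OF z] unfolding stabilizer_def by auto
      then show ?thesis using z s(1) by blast
    qed (use g in simp)
  qed
  moreover have "finite (H \<union> (\<Union>z\<in>H \<inter> orbit G act x. act (a z) ` ?Y))"
    using H finY by auto
  ultimately show False using inf(2) finite_subset by blast
qed

lemma proximal_iff:
  assumes x: "x \<in> F" and y: "y \<in> F" and "x \<noteq> y"
  shows "proximal (fort_topology F b) G act x y \<longleftrightarrow>
    (x = b \<or> infinite (orbit G act x)) \<and> (y = b \<or> infinite (orbit G act y))"
proof
  let ?X = "fort_topology F b"
  assume "proximal ?X G act x y"
  then obtain z N where z: "z \<in> F" and N: "N \<noteq> bot" "\<forall>\<^sub>F g in N. g \<in> carrier G"
    and lim: "limitin ?X (\<lambda>g. act g x) z N" "limitin ?X (\<lambda>g. act g y) z N"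
    unfolding proximal_def by auto
  have "z = b"
  proof (rule ccontr)
    assume "z \<noteq> b"
    then have "openin ?X {z}" using z by (rule openin_fort_singleton[rotated])
    then have "\<forall>\<^sub>F g in N. act g x \<in> {z}" "\<forall>\<^sub>F g in N. act g y \<in> {z}"
      using lim unfolding limitin_def by blast+
    then have "\<forall>\<^sub>F g in N. g \<in> carrier G \<and> act g x = act g y"
      using N(2) by eventually_elim auto
    then obtain g where "g \<in> carrier G" "act g x = act g y"
      using eventually_happens'[OF N(1)] by blast
    then show False using act_eq_iff x y \<open>x \<noteq> y\<close> by blast
  qed
  have "w = b \<or> infinite (orbit G act w)"
    if w: "w \<in> F" "limitin ?X (\<lambda>g. act g w) b N" for w
  proof (rule ccontr)
    assume *: "\<not> (w = b \<or> infinite (orbit G act w))"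
    \<comment> \<open>A finite orbit that avoids \<open>b\<close> has a neighbourhood of \<open>b\<close> as its complement.\<close>
    then have "openin ?X (F - orbit G act w)" by (intro openin_fort_Diff_finite) simp
    moreover have "b \<notin> orbit G act w"
      using * act_eq_b_iff[OF _ w(1)] unfolding orbit_def by auto
    ultimately have "\<forall>\<^sub>F g in N. act g w \<in> F - orbit G act w"
      using w(2) b_in unfolding limitin_def by auto
    then have "\<forall>\<^sub>F g in N. False"
      using N(2) by eventually_elim (auto simp: orbit_def)
    then show False using N(1) by (simp add: trivial_limit_def)
  qed
  then show "(x = b \<or> infinite (orbit G act x)) \<and> (y = b \<or> infinite (orbit G act y))"
    using lim x y \<open>z = b\<close> by blast
next
  let ?X = "fort_topology F b" and ?I = "{H. finite H \<and> b \<notin> H}"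
  assume "(x = b \<or> infinite (orbit G act x)) \<and> (y = b \<or> infinite (orbit G act y))"
  \<comment> \<open>If one of the points is \<open>b\<close>, only the other has to be moved, so it can be taken twice.\<close>
  then have "\<exists>w\<in>F. \<exists>w'\<in>F. infinite (orbit G act w) \<and> infinite (orbit G act w') \<and>
      x \<in> {b, w, w'} \<and> y \<in> {b, w, w'}"
    using x y \<open>x \<noteq> y\<close> by (elim conjE disjE) auto
  then obtain w w' where w: "w \<in> F" "w' \<in> F" "infinite (orbit G act w)"
      "infinite (orbit G act w')" and xy: "x \<in> {b, w, w'}" "y \<in> {b, w, w'}"
    by blast
  \<comment> \<open>The finite sets avoiding \<open>b\<close> index the net: their complements form a base at \<open>b\<close>.\<close>
  have "\<exists>g. g \<in> carrier G \<and> act g x \<notin> H \<and> act g y \<notin> H" if "H \<in> ?I" for H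
  proof -
    from that have H: "finite H" "b \<notin> H" by auto
    obtain g where "g \<in> carrier G" "act g w \<notin> H" "act g w' \<notin> H"
      using avoid_finite_set[OF w H(1)] by blast
    then show ?thesis using xy H(2) act_b[of g] by auto
  qed
  then obtain g where g: "\<And>H. H \<in> ?I \<Longrightarrow>
      g H \<in> carrier G \<and> act (g H) x \<notin> H \<and> act (g H) y \<notin> H"
    by metis
  have net: "net_limit ?X ?I (\<subseteq>) (\<lambda>H. act (g H) u) b" if u: "u \<in> {x, y}" for u
    unfolding net_limit_def
  proof (intro conjI allI impI)
    fix U assume U: "openin ?X U \<and> b \<in> U"
    then have "F - U \<in> ?I" by (simp add: openin_fort_topology)
    moreover have "act (g H) u \<in> U" if "H \<in> ?I" "F - U \<subseteq> H" for H
      using g[OF that(1)] that(2) u x y act_closed[of "g H" u] by blast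
    ultimately show "\<exists>H\<in>?I. \<forall>H'\<in>?I. H \<subseteq> H' \<longrightarrow> act (g H') u \<in> U" by blast
  qed (use b_in in simp)
  have "directed ?I (\<subseteq>)"
    unfolding directed_def
  proof (intro conjI ballI)
    fix H K assume "H \<in> ?I" "K \<in> ?I"
    then show "\<exists>L\<in>?I. H \<subseteq> L \<and> K \<subseteq> L" by (intro bexI[of _ "H \<union> K"]) auto
  qed auto
  then show "proximal ?X G act x y"
  proof (rule proximal_if_net[where g = g])
    show "net_limit ?X ?I (\<subseteq>) (\<lambda>H. act (g H) x) b"
      "net_limit ?X ?I (\<subseteq>) (\<lambda>H. act (g H) y) b" by (intro net; simp)+
  qed (use g in blast)
qed

section \<open>Asymptotic pairs\<close>

lemma asymptotic_mod_iff_finite_sets: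
  assumes I: "set_ideal (carrier G) I" and x: "x \<in> F" and y: "y \<in> F" and "x \<noteq> y"
  shows "asymptotic_mod (fort_topology F b) G act I x y \<longleftrightarrow>
    (\<forall>H. finite H \<and> b \<notin> H \<longrightarrow>
      {g \<in> carrier G. act g x \<in> H} \<in> I \<and> {g \<in> carrier G. act g y \<in> H} \<in> I)"
    (is "?L \<longleftrightarrow> ?R")
proof -
  have sub: "B \<in> I" if "A \<in> I" "B \<subseteq> A" for A B
    using I that unfolding set_ideal_def by blast
  have un: "A \<union> B \<in> I" if "A \<in> I" "B \<in> I" for A B
    using I that unfolding set_ideal_def by blast
  \<comment> \<open>The action is injective, so two distinct points never meet and the diagonal part of an
    entourage is irrelevant.\<close>
  have far: "{g \<in> carrier G. (act g x, act g y) \<notin> fort_entourage F H} =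
      {g \<in> carrier G. act g x \<in> H} \<union> {g \<in> carrier G. act g y \<in> H}" for H
    using act_eq_iff[OF _ x y] \<open>x \<noteq> y\<close> act_closed x y unfolding fort_entourage_def by auto
  note unif = the_uniform_structure_compact_Hausdorff(2)[OF compact Hausdorff]
  show ?thesis
  proof
    assume ?L
    show ?R
    proof (intro allI impI)
      fix H assume "finite H \<and> b \<notin> H"
      then have "{g \<in> carrier G. (act g x, act g y) \<notin> fort_entourage F H} \<in> I"
        using \<open>?L\<close> fort_entourage_in_diagonal_nbhds[of H b F] unfolding asymptotic_mod_def unif
        by blast
      then show "{g \<in> carrier G. act g x \<in> H} \<in> I \<and> {g \<in> carrier G. act g y \<in> H} \<in> I"
        unfolding far using sub by blast
    qed
  next
    assume ?R
    show ?L
      unfolding asymptotic_mod_def unif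
    proof
      fix \<alpha> assume "\<alpha> \<in> diagonal_nbhds (fort_topology F b)"
      then obtain H where H: "finite H" "b \<notin> H" "fort_entourage F H \<subseteq> \<alpha>"
        by (rule diagonal_nbhds_fort_topologyE[OF _ b_in])
      have "{g \<in> carrier G. (act g x, act g y) \<notin> fort_entourage F H} \<in> I"
        unfolding far using \<open>?R\<close> H(1,2) un by blast
      then show "{g \<in> carrier G. (act g x, act g y) \<notin> \<alpha>} \<in> I"
        by (rule sub) (use H(3) in blast)
    qed
  qed
qed

text \<open>
  The coset \<open>stab(x)h\<close> consists of the times at which \<open>x\<close> visits the single point \<open>xh\<close>, and
  \<open>xh \<noteq> b\<close> unless \<open>x = b\<close>. Unions of finitely many such sets give all visits to a finite set.
\<close>

lemma hitting_times_in_ideal_iff: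
  assumes I: "set_ideal (carrier G) I" and x: "x \<in> F"
  shows "(\<forall>H. finite H \<and> b \<notin> H \<longrightarrow> {g \<in> carrier G. act g x \<in> H} \<in> I) \<longleftrightarrow>
    x = b \<or> (\<forall>h\<in>carrier G. stabilizer G act x #> h \<in> I)"
    (is "?L \<longleftrightarrow> ?R")
proof
  assume ?L
  show ?R
  proof (cases "x = b")
    case False
    have "stabilizer G act x #> h \<in> I" if h: "h \<in> carrier G" for h
      using \<open>?L\<close>[rule_format, of "{act h x}"] False act_eq_b_iff[OF h x]
      unfolding coset_stabilizer_eq[OF x h] by simp
    then show ?thesis by blast
  qed simp
next
  assume ?R
  have empty: "{} \<in> I" using I unfolding set_ideal_def by blast
  show ?L
  proof (intro allI impI, elim conjE)
    fix H assume "finite H" "b \<notin> H"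
    then show "{g \<in> carrier G. act g x \<in> H} \<in> I"
    proof (induction H rule: finite_induct)
      case empty
      then show ?case using \<open>{} \<in> I\<close> by simp
    next
      case (insert z H)
      have "{g \<in> carrier G. act g x = z} \<in> I"
      proof (cases "\<exists>h\<in>carrier G. act h x = z")
        case True
        then obtain h where h: "h \<in> carrier G" "act h x = z" by blast
        then have "x \<noteq> b" using insert.prems act_b by auto
        then show ?thesis using \<open>?R\<close> h coset_stabilizer_eq[OF x h(1)] by auto
      next
        case False
        then have "{g \<in> carrier G. act g x = z} = {}" by blast
        then show ?thesis using \<open>{} \<in> I\<close> by metis
      qed
      moreover have "{g \<in> carrier G. act g x \<in> H} \<in> I" using insert by simp
      moreover have "{g \<in> carrier G. act g x \<in> insert z H} =
          {g \<in> carrier G. act g x = z} \<union> {g \<in> carrier G. act g x \<in> H}" by auto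
      ultimately show ?case using I unfolding set_ideal_def by simp
    qed
  qed
qed

lemma asymptotic_mod_iff:
  assumes "set_ideal (carrier G) I" "x \<in> F" "y \<in> F" "x \<noteq> y"
  shows "asymptotic_mod (fort_topology F b) G act I x y \<longleftrightarrow>
    (x = b \<or> (\<forall>h\<in>carrier G. stabilizer G act x #> h \<in> I)) \<and>
    (y = b \<or> (\<forall>h\<in>carrier G. stabilizer G act y #> h \<in> I))"
  by (simp only: asymptotic_mod_iff_finite_sets[OF assms] imp_conjR all_conj_distrib
    hitting_times_in_ideal_iff[OF assms(1,2)] hitting_times_in_ideal_iff[OF assms(1,3)])

section \<open>Li--Yorke chaos\<close>

theorem Li_Yorke_chaotic_mod_iff:
  assumes I: "set_ideal (carrier G) I"
  shows "Li_Yorke_chaotic_mod (fort_topology F b) G act I \<longleftrightarrow>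
    uncountable {x \<in> F. infinite (orbit G act x) \<and>
      (\<exists>h\<in>carrier G. stabilizer G act x #> h \<notin> I)}"
proof -
  let ?X = "fort_topology F b"
  define A where "A = {x \<in> F. infinite (orbit G act x) \<and>
    (\<exists>h\<in>carrier G. stabilizer G act x #> h \<notin> I)}"
  have A_iff: "w \<in> A \<longleftrightarrow> w \<noteq> b \<and> infinite (orbit G act w) \<and>
      \<not> (\<forall>h\<in>carrier G. stabilizer G act w #> h \<in> I)" if "w \<in> F" for w
    using that finite_orbit_b unfolding A_def by auto
  have scr: "scrambled_mod ?X G act I x y \<longleftrightarrow>
      (x = b \<or> infinite (orbit G act x)) \<and> (y = b \<or> infinite (orbit G act y)) \<and>
      (x \<in> A \<or> y \<in> A)"
    if xy: "x \<in> F" "y \<in> F" "x \<noteq> y" for x y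
    using A_iff[OF xy(1)] A_iff[OF xy(2)]
    unfolding scrambled_mod_def proximal_iff[OF xy] asymptotic_mod_iff[OF I xy] by argo
  have "Li_Yorke_chaotic_mod ?X G act I \<longleftrightarrow> uncountable A"
  proof
    assume "Li_Yorke_chaotic_mod ?X G act I"
    then obtain D where D: "uncountable D" "D \<subseteq> F"
      "\<forall>x\<in>D. \<forall>y\<in>D. x \<noteq> y \<longrightarrow> scrambled_mod ?X G act I x y"
      unfolding Li_Yorke_chaotic_mod_def scrambled_set_mod_def by auto
    have "x = y" if "x \<in> D - A" "y \<in> D - A" for x y
      using that D(2,3) scr[of x y] by blast
    then have "D - A \<subseteq> {SOME u. u \<in> D - A}" by (metis singletonI someI_ex subsetI)
    then have "D \<subseteq> insert (SOME u. u \<in> D - A) A" by auto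
    then show "uncountable A"
      using D(1) countable_subset countable_insert by metis
  next
    assume unc: "uncountable A"
    then obtain x where x: "x \<in> A" by fastforce
    have "\<not> A \<subseteq> {x}" using unc countable_subset[of A "{x}"] by auto
    then have "\<exists>x\<in>A. \<exists>y\<in>A. x \<noteq> y" using x by blast
    moreover have AF: "A \<subseteq> F" unfolding A_def by blast
    moreover have "scrambled_mod ?X G act I x y" if "x \<in> A" "y \<in> A" "x \<noteq> y" for x y
      using that AF scr[of x y] A_iff[of x] A_iff[of y] by auto
    ultimately have "scrambled_set_mod ?X G act I A"
      unfolding scrambled_set_mod_def by simp
    then show "Li_Yorke_chaotic_mod ?X G act I"
      using unc unfolding Li_Yorke_chaotic_mod_def by blast
  qed
  then show ?thesis unfolding A_def .
qed

end

lemma coset_in_invariant_ideal_iff: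
  fixes G (structure)
  assumes "group G" "invariant_ideal G J" "S \<subseteq> carrier G" "h \<in> carrier G"
  shows "S #> h \<in> J \<longleftrightarrow> S \<in> J"
proof
  interpret group G by (rule assms(1))
  assume "S #> h \<in> J"
  then have "(S #> h) #> inv h \<in> J" using assms unfolding invariant_ideal_def by blast
  then show "S \<in> J" using assms by (simp add: coset_mult_assoc)
next
  assume "S \<in> J"
  then show "S #> h \<in> J" using assms unfolding invariant_ideal_def by blast
qed

lemma invariant_ideal_finite_subsets:
  fixes G (structure)
  assumes "group G"
  shows "invariant_ideal G {A. A \<subseteq> carrier G \<and> finite A}"
proof -
  interpret group G by (rule assms)
  have "finite (A #> g)" if "finite A" for A g
    using that unfolding r_coset_def by auto
  then show ?thesis
    unfolding invariant_ideal_def set_ideal_def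
    by (auto intro: finite_subset dest: r_coset_subset_G)
qed

context fort_transformation_group
begin

theorem Li_Yorke_chaotic_mod_invariant_iff:
  assumes J: "invariant_ideal G J"
  shows "Li_Yorke_chaotic_mod (fort_topology F b) G act J \<longleftrightarrow>
    uncountable {x \<in> F. infinite (orbit G act x) \<and> stabilizer G act x \<notin> J}"
proof -
  have "stabilizer G act x \<subseteq> carrier G" for x unfolding stabilizer_def by blast
  then have "(\<exists>h\<in>carrier G. stabilizer G act x #> h \<notin> J) \<longleftrightarrow> stabilizer G act x \<notin> J" for x
    using coset_in_invariant_ideal_iff[OF group J] group.is_monoid[OF group] monoid.one_closed
    by metis
  moreover have "set_ideal (carrier G) J" using J unfolding invariant_ideal_def by blast
  ultimately show ?thesis using Li_Yorke_chaotic_mod_iff by simp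
qed

theorem Li_Yorke_chaotic_iff:
  "Li_Yorke_chaotic (fort_topology F b) G act \<longleftrightarrow>
    uncountable {x \<in> F. infinite (orbit G act x) \<and> infinite (stabilizer G act x)}"
proof -
  have "stabilizer G act x \<subseteq> carrier G" for x unfolding stabilizer_def by blast
  then have "stabilizer G act x \<notin> {A. A \<subseteq> carrier G \<and> finite A} \<longleftrightarrow>
      infinite (stabilizer G act x)" for x
    by simp
  then show ?thesis
    using Li_Yorke_chaotic_mod_invariant_iff[OF invariant_ideal_finite_subsets[OF group]]
    unfolding Li_Yorke_chaotic_def by (simp only:)
qed

end

theorem theorem4p7:
  fixes F :: "'x set" and b :: 'x
    and G :: "('g, 'm) monoid_scheme" and act :: "'g \<Rightarrow> 'x \<Rightarrow> 'x"
  assumes "b \<in> F" and "infinite F"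
    and "transformation_group (fort_topology F b) G act"
    and "comm_group G"
  shows "(\<forall>I. set_ideal (carrier G) I \<longrightarrow>
            (Li_Yorke_chaotic_mod (fort_topology F b) G act I \<longleftrightarrow>
             uncountable {x \<in> F. infinite (orbit G act x) \<and>
               (\<exists>h\<in>carrier G. stabilizer G act x #>\<^bsub>G\<^esub> h \<notin> I)}))
       \<and> (\<forall>J. invariant_ideal G J \<longrightarrow>
            (Li_Yorke_chaotic_mod (fort_topology F b) G act J \<longleftrightarrow>
             uncountable {x \<in> F. infinite (orbit G act x) \<and> stabilizer G act x \<notin> J}))
       \<and> (Li_Yorke_chaotic (fort_topology F b) G act \<longleftrightarrow>
             uncountable {x \<in> F. infinite (orbit G act x) \<and> infinite (stabilizer G act x)})"
proof -
  interpret fort_transformation_group F b G act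
    using assms by (simp add: fort_transformation_group_def fort_transformation_group_axioms_def)
  show ?thesis
    by (intro conjI allI impI Li_Yorke_chaotic_mod_iff Li_Yorke_chaotic_mod_invariant_iff
      Li_Yorke_chaotic_iff)
qed

end
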